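(* Let $R$ be a commutative ring with nonzero identity. (1) $GD(R)$ is compact if and only if $\mathcal R_{\mathrm{pr}}(R)$ has a finite coinitial subset. (2) $GD(R)$ is Lindelöf if and only if $\mathcal R_{\mathrm{pr}}(R)$ has a countable coinitial subset.
   Context: For a commutative ring $R$ with nonzero identity and unit group $U(R)$, let $R^\#=R\setminus(U(R)\cup\{0\})$ be the set of nonzero nonunits. For $a,b\in R^\#$ write $a\sim b$ if $aR=bR$; $[a]$ denotes the equivalence class of $a$ and $EC(R^\#)$ the set of equivalence classes. For $a\in R^\#$ put $B_a=\{[b]\in EC(R^\#): b\mid a^n\text{ for some }n\geq 1\}$. The sets $B_a$ ($a\in R^\#$) form a basis of a topology on $EC(R^\#)$; the resulting space is denoted $GD(R)$ (the generalized divisor topology). $\mathcal R_{\mathrm{pr}}(R)=\{\sqrt{aR}:a\in R^\#\}$, partially ordered by inclusion. A subset $C$ of a poset $P$ is coinitial if for every $x\in P$ there exists $c\in C$ with $c\leq x$. Compact means every open cover has a finite subcover (no separation axiom assumed); Lindelöf means every open cover has a countable subcover. Countable means at most countable. *)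

theory Defs
  imports "HOL-Algebra.Algebra" "HOL-Analysis.Analysis"
begin

definition nonzero_nonunits :: "('a, 'b) ring_scheme \<Rightarrow> 'a set" where
  "nonzero_nonunits R = carrier R - (Units R \<union> {\<zero>\<^bsub>R\<^esub>})"

definition principal_rel :: "('a, 'b) ring_scheme \<Rightarrow> ('a \<times> 'a) set" where
  "principal_rel R =
     {(a, b). a \<in> nonzero_nonunits R \<and> b \<in> nonzero_nonunits R \<and> PIdl\<^bsub>R\<^esub> a = PIdl\<^bsub>R\<^esub> b}"

definition EC :: "('a, 'b) ring_scheme \<Rightarrow> 'a set set" where
  "EC R = nonzero_nonunits R // principal_rel R"

definition divisor_class :: "('a, 'b) ring_scheme \<Rightarrow> 'a \<Rightarrow> 'a set" where
  "divisor_class R a = principal_rel R `` {a}"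

definition basic_open :: "('a, 'b) ring_scheme \<Rightarrow> 'a \<Rightarrow> 'a set set" where
  "basic_open R a =
     {divisor_class R b | b. b \<in> nonzero_nonunits R \<and> (\<exists>n::nat. n \<ge> 1 \<and> b divides\<^bsub>R\<^esub> (a [^]\<^bsub>R\<^esub> n))}"

(* The open sets are the arbitrary unions of basic open sets; see openin_GD and topspace_GD. *)
definition GD :: "('a, 'b) ring_scheme \<Rightarrow> 'a set topology" where
  "GD R = topology (arbitrary union_of (\<lambda>U. U \<in> basic_open R ` nonzero_nonunits R))"

definition ideal_radical :: "('a, 'b) ring_scheme \<Rightarrow> 'a set \<Rightarrow> 'a set" where
  "ideal_radical R I = {x \<in> carrier R. \<exists>n::nat. n \<ge> 1 \<and> x [^]\<^bsub>R\<^esub> n \<in> I}"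

definition principal_radicals :: "('a, 'b) ring_scheme \<Rightarrow> 'a set set" where
  "principal_radicals R = {ideal_radical R (PIdl\<^bsub>R\<^esub> a) | a. a \<in> nonzero_nonunits R}"

definition coinitial_in :: "'a::order set \<Rightarrow> 'a set \<Rightarrow> bool" where
  "coinitial_in C P \<longleftrightarrow> C \<subseteq> P \<and> (\<forall>x\<in>P. \<exists>c\<in>C. c \<le> x)"


lemma equiv_principal_rel: "equiv (nonzero_nonunits R) (principal_rel R)"
  by (auto simp: principal_rel_def equiv_def refl_on_def sym_on_def trans_on_def)

lemma basic_open_subset_EC: "basic_open R a \<subseteq> EC R"
  by (auto simp: basic_open_def EC_def divisor_class_def quotient_def)

context cring
begin

lemma divides_if_PIdl_eq:
  assumes "a \<in> carrier R" "b \<in> carrier R" "PIdl a = PIdl b"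
  shows "a divides b"
proof -
  have "b \<in> PIdl a"
    using assms cgenideal_self by auto
  then show ?thesis
    using assms by (auto simp: cgenideal_def factor_def m_comm)
qed

lemma divisor_class_in_basic_open_iff:
  assumes "a \<in> carrier R" "b \<in> nonzero_nonunits R"
  shows "divisor_class R b \<in> basic_open R a \<longleftrightarrow> (\<exists>n::nat. n \<ge> 1 \<and> b divides (a [^] n))"
proof
  assume "divisor_class R b \<in> basic_open R a"
  then obtain c n where c: "c \<in> nonzero_nonunits R" "divisor_class R b = divisor_class R c"
    and n: "n \<ge> (1::nat)" "c divides (a [^] n)"
    by (auto simp: basic_open_def)
  have "(b, c) \<in> principal_rel R"
    using c assms by (metis divisor_class_def eq_equiv_class_iff equiv_principal_rel)
  then have "b divides c"
    using divides_if_PIdl_eq by (auto simp: principal_rel_def nonzero_nonunits_def)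
  then show "\<exists>n::nat. n \<ge> 1 \<and> b divides (a [^] n)"
    using n assms divides_trans by (metis nonzero_nonunits_def Diff_iff)
qed (use assms in \<open>auto simp: basic_open_def\<close>)

lemma basic_open_refl:
  assumes "a \<in> nonzero_nonunits R"
  shows "divisor_class R a \<in> basic_open R a"
proof -
  have "a \<in> carrier R" using assms by (simp add: nonzero_nonunits_def)
  then have "a divides (a [^] (1::nat))" by simp
  then show ?thesis using assms unfolding basic_open_def by blast
qed

lemma basic_open_mono:
  assumes a: "a \<in> nonzero_nonunits R" and d: "d \<in> nonzero_nonunits R"
    and da: "divisor_class R d \<in> basic_open R a"
  shows "basic_open R d \<subseteq> basic_open R a"
proof
  fix U assume "U \<in> basic_open R d"
  then obtain b n where b: "b \<in> nonzero_nonunits R" "U = divisor_class R b"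
    and n: "n \<ge> (1::nat)" "b divides (d [^] n)"
    by (auto simp: basic_open_def)
  have car: "a \<in> carrier R" "b \<in> carrier R" "d \<in> carrier R"
    using a b d by (auto simp: nonzero_nonunits_def)
  obtain m where m: "m \<ge> (1::nat)" "d divides (a [^] m)"
    using da car d divisor_class_in_basic_open_iff by blast
  from m(2) obtain c where c: "c \<in> carrier R" "a [^] m = d \<otimes> c"
    by (auto simp: factor_def)
  have "a [^] (m * n) = d [^] n \<otimes> c [^] n"
    using c car by (metis nat_pow_distrib nat_pow_pow)
  then have "(d [^] n) divides (a [^] (m * n))"
    using c by (auto simp: factor_def)
  then have "b divides (a [^] (m * n))"
    using n car divides_trans by blast
  moreover have "m * n \<ge> 1"
    using m n by simp
  ultimately show "U \<in> basic_open R a"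
    using b unfolding basic_open_def by blast
qed

lemma openin_GD: "openin (GD R) = arbitrary union_of (\<lambda>U. U \<in> basic_open R ` nonzero_nonunits R)"
proof -
  let ?P = "\<lambda>U. U \<in> basic_open R ` nonzero_nonunits R"
  have "(arbitrary union_of ?P) (S \<inter> T)" if ST: "?P S" "?P T" for S T
  proof -
    have "\<exists>V. ?P V \<and> U \<in> V \<and> V \<subseteq> S \<inter> T" if U: "U \<in> S \<inter> T" for U
    proof -
      obtain d where d: "d \<in> nonzero_nonunits R" "U = divisor_class R d"
        using U ST by (auto simp: basic_open_def)
      then show ?thesis
        using U ST basic_open_refl basic_open_mono by (intro exI[of _ "basic_open R d"]) blast
    qed
    then show ?thesis
      by (subst arbitrary_union_of_alt) blast
  qed
  then have "istopology (arbitrary union_of ?P)"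
    by (simp only: istopology_base_eq) blast
  then show ?thesis
    by (simp add: GD_def topology_inverse')
qed

lemma topspace_GD: "topspace (GD R) = EC R"
proof
  show "topspace (GD R) \<subseteq> EC R"
    unfolding topspace_def openin_GD using basic_open_subset_EC
    by (fastforce simp: union_of_def)
next
  show "EC R \<subseteq> topspace (GD R)"
  proof
    fix U assume "U \<in> EC R"
    then obtain a where a: "a \<in> nonzero_nonunits R" "U = divisor_class R a"
      by (auto simp: EC_def divisor_class_def quotient_def)
    then have "openin (GD R) (basic_open R a)"
      unfolding openin_GD by (simp add: arbitrary_union_of_inc)
    then show "U \<in> topspace (GD R)"
      using a basic_open_refl openin_subset by blast
  qed
qed

end

end

theory Submission
  imports Defs
begin

text \<open>
  Both equivalences rest on the same dictionary.  For nonzero nonunits \<open>a\<close> and \<open>b\<close>, the class of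
  \<open>b\<close> lies in \<open>basic_open R a\<close> iff some power of \<open>a\<close> lies in \<open>bR\<close>, that is, iff the radical of
  \<open>aR\<close> is contained in the radical of \<open>bR\<close>.  So sets \<open>basic_open R a\<close>, for \<open>a\<close> in \<open>D\<close>, cover
  \<open>EC R\<close> exactly when below every principal radical there is the radical of some element of \<open>D\<close>,
  i.e. when these radicals are coinitial (\<open>basic_opens_cover_iff_coinitial\<close>).

  On the topological side, \<open>basic_open R a\<close> is the least open set containing the class of \<open>a\<close>
  (\<open>basic_open_least\<close>).  In a space whose points have least neighbourhoods, the cover by all of
  these is the worst possible open cover: any subcover of it gives a subcover of every other open
  cover, indexed by the same points.  Hence compactness and the Lindelof property say that
  finitely, respectively countably, many least neighbourhoods suffice.
\<close>

section \<open>Open covers in spaces with least neighbourhoods\<close>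

text \<open>
  Each least neighbourhood \<open>N i\<close> lies inside whichever member of the cover contains the point
  \<open>p i\<close>; choosing such a member for every index in \<open>D\<close> gives the subcover.  It is stated as an
  image of \<open>D\<close> so that it inherits finiteness or countability.
\<close>

lemma subcover_indexed_by_least_neighbourhoods:
  assumes least: "\<And>i U. \<lbrakk>i \<in> D; openin T U; p i \<in> U\<rbrakk> \<Longrightarrow> N i \<subseteq> U"
    and points: "p ` D \<subseteq> topspace T"
    and cover: "\<Union>(N ` D) = topspace T"
    and \<U>: "\<And>U. U \<in> \<U> \<Longrightarrow> openin T U" "\<Union>\<U> = topspace T"
  obtains f where "f ` D \<subseteq> \<U>" "\<Union>(f ` D) = topspace T"
proof -
  have "\<forall>i\<in>D. \<exists>U\<in>\<U>. p i \<in> U"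
    using points \<U>(2) by blast
  then obtain f where f: "\<And>i. i \<in> D \<Longrightarrow> f i \<in> \<U> \<and> p i \<in> f i"
    by metis
  then have "N i \<subseteq> f i" if "i \<in> D" for i
    using least \<U>(1) that by blast
  then have "topspace T \<subseteq> \<Union>(f ` D)"
    using cover by blast
  moreover have "f ` D \<subseteq> \<U>"
    using f by blast
  ultimately show thesis
    using that \<U>(2) by (metis Union_mono subset_antisym)
qed

lemma compact_space_least_neighbourhoods:
  assumes N: "\<And>i. i \<in> I \<Longrightarrow> openin T (N i)"
    and least: "\<And>i U. \<lbrakk>i \<in> I; openin T U; p i \<in> U\<rbrakk> \<Longrightarrow> N i \<subseteq> U"
    and points: "p ` I \<subseteq> topspace T"
    and cover: "\<Union>(N ` I) = topspace T"
  shows "compact_space T \<longleftrightarrow> (\<exists>D. finite D \<and> D \<subseteq> I \<and> \<Union>(N ` D) = topspace T)"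
proof
  assume "compact_space T"
  moreover have "\<forall>U\<in>N ` I. openin T U" "topspace T \<subseteq> \<Union>(N ` I)"
    using N cover by auto
  ultimately obtain \<F> where \<F>: "finite \<F>" "\<F> \<subseteq> N ` I" "topspace T \<subseteq> \<Union>\<F>"
    unfolding compact_space_alt by meson
  obtain D where D: "D \<subseteq> I" "finite D" "\<F> = N ` D"
    using \<F> finite_subset_image by metis
  then have "\<Union>(N ` D) = topspace T"
    using \<F>(3) cover by blast
  then show "\<exists>D. finite D \<and> D \<subseteq> I \<and> \<Union>(N ` D) = topspace T"
    using D by blast
next
  assume "\<exists>D. finite D \<and> D \<subseteq> I \<and> \<Union>(N ` D) = topspace T"
  then obtain D where D: "finite D" "D \<subseteq> I" "\<Union>(N ` D) = topspace T"
    by blast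
  show "compact_space T"
    unfolding compact_space
  proof (intro allI impI)
    fix \<U> assume \<U>: "(\<forall>U\<in>\<U>. openin T U) \<and> \<Union>\<U> = topspace T"
    obtain f where "f ` D \<subseteq> \<U>" "\<Union>(f ` D) = topspace T"
    proof (rule subcover_indexed_by_least_neighbourhoods[where \<U> = \<U>, OF _ _ D(3)])
      show "N i \<subseteq> U" if "i \<in> D" "openin T U" "p i \<in> U" for i U
        using least that D(2) by blast
      show "p ` D \<subseteq> topspace T"
        using points D(2) by blast
    qed (use \<U> in auto)
    then show "\<exists>\<F>. finite \<F> \<and> \<F> \<subseteq> \<U> \<and> \<Union>\<F> = topspace T"
      using D(1) by blast
  qed
qed

lemma Lindelof_space_least_neighbourhoods:
  assumes N: "\<And>i. i \<in> I \<Longrightarrow> openin T (N i)"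
    and least: "\<And>i U. \<lbrakk>i \<in> I; openin T U; p i \<in> U\<rbrakk> \<Longrightarrow> N i \<subseteq> U"
    and points: "p ` I \<subseteq> topspace T"
    and cover: "\<Union>(N ` I) = topspace T"
  shows "Lindelof_space T \<longleftrightarrow> (\<exists>D. countable D \<and> D \<subseteq> I \<and> \<Union>(N ` D) = topspace T)"
proof
  assume "Lindelof_space T"
  moreover have "\<forall>U\<in>N ` I. openin T U"
    using N by auto
  ultimately obtain \<F> where \<F>: "countable \<F>" "\<F> \<subseteq> N ` I" "\<Union>\<F> = topspace T"
    unfolding Lindelof_space_def using cover by meson
  obtain D where "D \<subseteq> I" "countable D" "\<F> = N ` D"
    using \<F> countable_subset_image by metis
  then show "\<exists>D. countable D \<and> D \<subseteq> I \<and> \<Union>(N ` D) = topspace T"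
    using \<F>(3) by blast
next
  assume "\<exists>D. countable D \<and> D \<subseteq> I \<and> \<Union>(N ` D) = topspace T"
  then obtain D where D: "countable D" "D \<subseteq> I" "\<Union>(N ` D) = topspace T"
    by blast
  show "Lindelof_space T"
    unfolding Lindelof_space_def
  proof (intro allI impI)
    fix \<U> assume \<U>: "(\<forall>U\<in>\<U>. openin T U) \<and> \<Union>\<U> = topspace T"
    obtain f where "f ` D \<subseteq> \<U>" "\<Union>(f ` D) = topspace T"
    proof (rule subcover_indexed_by_least_neighbourhoods[where \<U> = \<U>, OF _ _ D(3)])
      show "N i \<subseteq> U" if "i \<in> D" "openin T U" "p i \<in> U" for i U
        using least that D(2) by blast
      show "p ` D \<subseteq> topspace T"
        using points D(2) by blast
    qed (use \<U> in auto)
    then show "\<exists>\<F>. countable \<F> \<and> \<F> \<subseteq> \<U> \<and> \<Union>\<F> = topspace T"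
      using D(1) by blast
  qed
qed

section \<open>Radicals of principal ideals and the generalized divisor topology\<close>

context cring
begin

lemma in_PIdl_iff_divides:
  assumes "b \<in> carrier R" "x \<in> carrier R"
  shows "x \<in> PIdl b \<longleftrightarrow> b divides x"
  using assms by (auto simp: cgenideal_def factor_def m_comm)

text \<open>
  If \<open>a\<^sup>m = bc\<close> and \<open>x\<^sup>n = ar\<close>, then \<open>x^(nm) = a\<^sup>mr\<^sup>m\<close> is divisible by \<open>b\<close>.  Conversely \<open>a\<close> itself
  belongs to the radical of \<open>aR\<close>.
\<close>

lemma divides_power_iff_radical_subset:
  assumes a: "a \<in> carrier R" and b: "b \<in> carrier R"
  shows "(\<exists>n::nat. n \<ge> 1 \<and> b divides (a [^] n)) \<longleftrightarrow>
         ideal_radical R (PIdl a) \<subseteq> ideal_radical R (PIdl b)"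
proof
  assume "\<exists>n::nat. n \<ge> 1 \<and> b divides (a [^] n)"
  then obtain m :: nat where m: "m \<ge> 1" "b divides (a [^] m)"
    by blast
  show "ideal_radical R (PIdl a) \<subseteq> ideal_radical R (PIdl b)"
  proof
    fix x assume "x \<in> ideal_radical R (PIdl a)"
    then obtain n :: nat where x: "x \<in> carrier R" and n: "n \<ge> 1" "x [^] n \<in> PIdl a"
      by (auto simp: ideal_radical_def)
    then obtain r where r: "r \<in> carrier R" "x [^] n = a \<otimes> r"
      using a in_PIdl_iff_divides by (auto simp: factor_def)
    have "x [^] (n * m) = a [^] m \<otimes> r [^] m"
      using a r x by (metis nat_pow_distrib nat_pow_pow)
    then have "(a [^] m) divides (x [^] (n * m))"
      using r by (auto simp: factor_def)
    then have "b divides (x [^] (n * m))"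
      using m(2) b divides_trans by blast
    moreover have "n * m \<ge> 1"
      using n(1) m(1) by simp
    ultimately show "x \<in> ideal_radical R (PIdl b)"
      unfolding ideal_radical_def using x in_PIdl_iff_divides[OF b nat_pow_closed[OF x]] by blast
  qed
next
  assume sub: "ideal_radical R (PIdl a) \<subseteq> ideal_radical R (PIdl b)"
  have "a [^] (1::nat) = a"
    using a by (rule nat_pow_eone)
  then have "a [^] (1::nat) \<in> PIdl a"
    using cgenideal_self[OF a] by (rule ssubst)
  then have "a \<in> ideal_radical R (PIdl a)"
    using a unfolding ideal_radical_def by blast
  then have "a \<in> ideal_radical R (PIdl b)"
    using sub by blast
  then obtain n :: nat where "n \<ge> 1" "a [^] n \<in> PIdl b"
    unfolding ideal_radical_def by blast
  then show "\<exists>n::nat. n \<ge> 1 \<and> b divides (a [^] n)"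
    using in_PIdl_iff_divides[OF b nat_pow_closed[OF a]] by blast
qed

lemma divisor_class_in_basic_open_iff_radical_subset:
  assumes "a \<in> nonzero_nonunits R" "b \<in> nonzero_nonunits R"
  shows "divisor_class R b \<in> basic_open R a \<longleftrightarrow>
         ideal_radical R (PIdl a) \<subseteq> ideal_radical R (PIdl b)"
  using assms divisor_class_in_basic_open_iff divides_power_iff_radical_subset
  by (simp add: nonzero_nonunits_def)

lemma EC_eq_image: "EC R = divisor_class R ` nonzero_nonunits R"
  by (auto simp: EC_def divisor_class_def quotient_def)

lemma basic_opens_cover_iff_coinitial:
  assumes D: "D \<subseteq> nonzero_nonunits R"
  shows "\<Union>(basic_open R ` D) = EC R \<longleftrightarrow>
         coinitial_in ((\<lambda>a. ideal_radical R (PIdl a)) ` D) (principal_radicals R)"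
proof -
  have "\<Union>(basic_open R ` D) = EC R \<longleftrightarrow>
        (\<forall>b\<in>nonzero_nonunits R. \<exists>a\<in>D. divisor_class R b \<in> basic_open R a)"
  proof -
    have "\<Union>(basic_open R ` D) = EC R \<longleftrightarrow> EC R \<subseteq> \<Union>(basic_open R ` D)"
      using basic_open_subset_EC[of R] by blast
    then show ?thesis
      unfolding EC_eq_image by blast
  qed
  also have "\<dots> \<longleftrightarrow> (\<forall>b\<in>nonzero_nonunits R. \<exists>a\<in>D.
        ideal_radical R (PIdl a) \<subseteq> ideal_radical R (PIdl b))"
    using D divisor_class_in_basic_open_iff_radical_subset by (meson subsetD)
  also have "\<dots> \<longleftrightarrow>
        coinitial_in ((\<lambda>a. ideal_radical R (PIdl a)) ` D) (principal_radicals R)"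
    using D by (auto simp: coinitial_in_def principal_radicals_def)
  finally show ?thesis .
qed

lemma openin_basic_open:
  assumes "a \<in> nonzero_nonunits R"
  shows "openin (GD R) (basic_open R a)"
  using assms unfolding openin_GD by (simp add: arbitrary_union_of_inc)

text \<open>
  A basic open set around the class of \<open>a\<close> contains \<open>basic_open R a\<close> because divisibility of a
  power is transitive; every open set is a union of basic ones.
\<close>

lemma basic_open_least:
  assumes a: "a \<in> nonzero_nonunits R" and U: "openin (GD R) U" "divisor_class R a \<in> U"
  shows "basic_open R a \<subseteq> U"
proof -
  obtain c where "c \<in> nonzero_nonunits R" "divisor_class R a \<in> basic_open R c"
    and "basic_open R c \<subseteq> U"
    using U unfolding openin_GD arbitrary_union_of_alt by blast
  then show ?thesis
    using a basic_open_mono by blast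
qed

lemma basic_opens_cover: "\<Union>(basic_open R ` nonzero_nonunits R) = topspace (GD R)"
proof
  show "\<Union>(basic_open R ` nonzero_nonunits R) \<subseteq> topspace (GD R)"
    unfolding topspace_GD using basic_open_subset_EC[of R] by blast
  show "topspace (GD R) \<subseteq> \<Union>(basic_open R ` nonzero_nonunits R)"
    unfolding topspace_GD EC_eq_image using basic_open_refl by blast
qed

lemma principal_radicals_eq_image:
  "principal_radicals R = (\<lambda>a. ideal_radical R (PIdl a)) ` nonzero_nonunits R"
  by (auto simp: principal_radicals_def)

lemma compact_space_GD_iff:
  "compact_space (GD R) \<longleftrightarrow> (\<exists>C. finite C \<and> coinitial_in C (principal_radicals R))"
proof -
  let ?rad = "\<lambda>a. ideal_radical R (PIdl a)"
  have "compact_space (GD R) \<longleftrightarrow>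
        (\<exists>D. finite D \<and> D \<subseteq> nonzero_nonunits R \<and> \<Union>(basic_open R ` D) = EC R)"
    unfolding topspace_GD[symmetric]
    by (rule compact_space_least_neighbourhoods[where p = "divisor_class R",
          OF openin_basic_open basic_open_least _ basic_opens_cover])
      (auto simp: topspace_GD EC_eq_image)
  also have "\<dots> \<longleftrightarrow> (\<exists>D. finite D \<and> D \<subseteq> nonzero_nonunits R \<and>
        coinitial_in (?rad ` D) (principal_radicals R))"
    using basic_opens_cover_iff_coinitial by blast
  also have "\<dots> \<longleftrightarrow> (\<exists>C. finite C \<and> coinitial_in C (principal_radicals R))"
    (is "?lhs \<longleftrightarrow> ?rhs")
  proof
    assume ?rhs
    then obtain C where C: "finite C" "coinitial_in C (principal_radicals R)"
      by blast
    then have "C \<subseteq> ?rad ` nonzero_nonunits R"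
      by (simp add: coinitial_in_def principal_radicals_eq_image)
    \<comment> \<open>One generator for each ideal in \<open>C\<close> is enough, which keeps \<open>D\<close> finite.\<close>
    then obtain D where "D \<subseteq> nonzero_nonunits R" "finite D" "C = ?rad ` D"
      using C(1) finite_subset_image by metis
    then show ?lhs
      using C(2) by blast
  next
    assume ?lhs
    then obtain D where D: "finite D" "coinitial_in (?rad ` D) (principal_radicals R)"
      by blast
    then show ?rhs
      using finite_imageI[OF D(1), of ?rad] by (intro exI conjI)
  qed
  finally show ?thesis .
qed

lemma Lindelof_space_GD_iff:
  "Lindelof_space (GD R) \<longleftrightarrow> (\<exists>C. countable C \<and> coinitial_in C (principal_radicals R))"
proof -
  let ?rad = "\<lambda>a. ideal_radical R (PIdl a)"
  have "Lindelof_space (GD R) \<longleftrightarrow>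
        (\<exists>D. countable D \<and> D \<subseteq> nonzero_nonunits R \<and> \<Union>(basic_open R ` D) = EC R)"
    unfolding topspace_GD[symmetric]
    by (rule Lindelof_space_least_neighbourhoods[where p = "divisor_class R",
          OF openin_basic_open basic_open_least _ basic_opens_cover])
      (auto simp: topspace_GD EC_eq_image)
  also have "\<dots> \<longleftrightarrow> (\<exists>D. countable D \<and> D \<subseteq> nonzero_nonunits R \<and>
        coinitial_in (?rad ` D) (principal_radicals R))"
    using basic_opens_cover_iff_coinitial by blast
  also have "\<dots> \<longleftrightarrow> (\<exists>C. countable C \<and> coinitial_in C (principal_radicals R))"
    (is "?lhs \<longleftrightarrow> ?rhs")
  proof
    assume ?rhs
    then obtain C where C: "countable C" "coinitial_in C (principal_radicals R)"
      by blast
    then have "C \<subseteq> ?rad ` nonzero_nonunits R"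
      by (simp add: coinitial_in_def principal_radicals_eq_image)
    \<comment> \<open>One generator for each ideal in \<open>C\<close> is enough, which keeps \<open>D\<close> countable.\<close>
    then obtain D where "D \<subseteq> nonzero_nonunits R" "countable D" "C = ?rad ` D"
      using C(1) countable_subset_image by metis
    then show ?lhs
      using C(2) by blast
  next
    assume ?lhs
    then obtain D where D: "countable D" "coinitial_in (?rad ` D) (principal_radicals R)"
      by blast
    then show ?rhs
      using countable_image[OF D(1), of ?rad] by (intro exI conjI)
  qed
  finally show ?thesis .
qed

end

theorem theorem4p3:
  fixes R :: "('a, 'b) ring_scheme"
  assumes "cring R" and "\<one>\<^bsub>R\<^esub> \<noteq> \<zero>\<^bsub>R\<^esub>"
  shows "(compact_space (GD R) \<longleftrightarrow>
            (\<exists>C. finite C \<and> coinitial_in C (principal_radicals R))) \<and>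
         (Lindelof_space (GD R) \<longleftrightarrow>
            (\<exists>C. countable C \<and> coinitial_in C (principal_radicals R)))"
  using cring.compact_space_GD_iff[OF assms(1)] cring.Lindelof_space_GD_iff[OF assms(1)]
  by blast

end
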